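(* Let $M<x<c/r$ and let $\pi^U$ be the optimal investment strategy for the problem $U(w,m;x,M)$ defined in the context. For $M<m\le w<x$, $$\pi^U(w)>\frac{\mu-r}{\sigma^2}\,\frac1{p-1}\left(\frac cr-w\right).$$
   Context: Market. Constants: riskless rate $r>0$, drift $\mu>r$, volatility $\sigma>0$, consumption rate $c>0$, hazard rate $\lambda>0$. An individual with wealth $W_t$ invests $\pi_t$ in a risky asset (geometric Brownian motion with drift $\mu$ and volatility $\sigma$) and $W_t-\pi_t$ in a riskless asset with rate $r$, and consumes at rate $c$, so $$dW_t=[rW_t+(\mu-r)\pi_t-c]\,dt+\sigma\pi_t\,dB_t,\qquad W_0=w,$$ with $B$ a standard Brownian motion. The minimum wealth process is $M_t=\min[\inf_{0\le s\le t}W_s,\,M_0]$, with $M_0=m\le w$ given. The time of death $\tau_d$ is exponentially distributed with parameter $\lambda$ and independent of $B$. A strategy $\pi$ is admissible if it is progressively measurable with respect to $(\mathcal F_t)$, the augmentation of $\sigma(W_s:0\le s\le t)$, and $\int_0^t\pi_s^2\,ds<\infty$ a.s. for all $t\ge0$. Constants: $$\delta=\frac12\left(\frac{\mu-r}{\sigma}\right)^2,\qquad p=\frac{1}{2r}\left[(r+\lambda+\delta)+\sqrt{(r+\lambda+\delta)^2-4r\lambda}\right]>1.$$ For $M<x<c/r$, with $(a)_+=\max(a,0)$, $$U(w,m;x,M)=\inf_\pi\mathbf E\left[(x-W_{\tau_d})_+\mathbf 1_{\{M_{\tau_d}>M\}}+(x-M)\mathbf 1_{\{M_{\tau_d}\le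 M\}}\mid W_0=w,\ M_0=m\right],$$ the infimum over admissible strategies. For $m>M$, $U$ does not depend on $m$; for $M<m\le w<c/r$ it solves, as a function of $w$, $$\lambda(U(w)-(x-w)_+)=(rw-c)U'(w)+\min_\pi\left[(\mu-r)\pi U'(w)+\tfrac12\sigma^2\pi^2U''(w)\right],\quad U(M)=x-M,\ U(c/r)=0,$$ and the optimal feedback strategy $\pi^U(w)$ is the minimizer, $\pi^U(w)=-\frac{\mu-r}{\sigma^2}\frac{U'(w)}{U''(w)}$. *)

theory Defs
  imports "HOL-Probability.Probability"
begin

section \<open>Processes and filtrations\<close>

text \<open>A real-valued process in continuous time is a function of type
  \<^typ>\<open>real \<Rightarrow> 'a \<Rightarrow> real\<close>; only its values at times \<open>t \<ge> 0\<close> matter.\<close>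

definition history :: "'a measure \<Rightarrow> (real \<Rightarrow> 'a \<Rightarrow> real) \<Rightarrow> real set \<Rightarrow> 'a set set" where
  "history P X S = (\<Union>s\<in>S. {X s -` A \<inter> space P |A. A \<in> sets borel})"

text \<open>The augmentation of \<open>\<sigma>(X\<^sub>s : 0 \<le> s \<le> t)\<close> by the \<open>P\<close>-null sets. The probability space is
  taken to be complete where this is used, so subsets of null sets are included.\<close>

definition aug_filtration :: "'a measure \<Rightarrow> (real \<Rightarrow> 'a \<Rightarrow> real) \<Rightarrow> real \<Rightarrow> 'a measure" where
  "aug_filtration P X t = sigma (space P) (history P X {0..t} \<union> null_sets P)"

definition adapted :: "(real \<Rightarrow> 'a measure) \<Rightarrow> (real \<Rightarrow> 'a \<Rightarrow> real) \<Rightarrow> bool" where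
  "adapted F X \<longleftrightarrow> (\<forall>t\<ge>0. X t \<in> borel_measurable (F t))"

definition progressive :: "(real \<Rightarrow> 'a measure) \<Rightarrow> (real \<Rightarrow> 'a \<Rightarrow> real) \<Rightarrow> bool" where
  "progressive F X \<longleftrightarrow>
     (\<forall>t\<ge>0. (\<lambda>(s, \<omega>). X s \<omega>) \<in> borel_measurable (restrict_space borel {0..t} \<Otimes>\<^sub>M F t))"

definition continuous_paths :: "'a measure \<Rightarrow> (real \<Rightarrow> 'a \<Rightarrow> real) \<Rightarrow> bool" where
  "continuous_paths P X \<longleftrightarrow> (AE \<omega> in P. continuous_on {0..} (\<lambda>t. X t \<omega>))"

definition brownian_motion :: "'a measure \<Rightarrow> (real \<Rightarrow> 'a \<Rightarrow> real) \<Rightarrow> bool" where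
  "brownian_motion P B \<longleftrightarrow>
     (\<forall>t\<ge>0. B t \<in> borel_measurable P) \<and>
     (AE \<omega> in P. B 0 \<omega> = 0) \<and>
     continuous_paths P B \<and>
     (\<forall>s t. 0 \<le> s \<and> s < t \<longrightarrow>
        distributed P lborel (\<lambda>\<omega>. B t \<omega> - B s \<omega>) (normal_density 0 (sqrt (t - s)))) \<and>
     (\<forall>n (t :: nat \<Rightarrow> real). 0 \<le> t 0 \<and> mono t \<longrightarrow>
        prob_space.indep_vars P (\<lambda>_. borel) (\<lambda>i \<omega>. B (t (Suc i)) \<omega> - B (t i) \<omega>) {..<n})"

text \<open>Independence of a random variable from the whole path of a process.\<close>

definition indep_of_process :: "'a measure \<Rightarrow> ('a \<Rightarrow> real) \<Rightarrow> (real \<Rightarrow> 'a \<Rightarrow> real) \<Rightarrow> bool" where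
  "indep_of_process P T X \<longleftrightarrow>
     prob_space.indep_set P {T -` A \<inter> space P |A. A \<in> sets borel}
       (sigma_sets (space P) (history P X {0..}))"


section \<open>The Ito integral\<close>

text \<open>A simple integrand is given by a number \<open>n\<close> of pieces, times \<open>0 \<le> t\<^sub>0 < \<dots> < t\<^sub>n\<close> and bounded
  \<open>F\<^bsub>t\<^sub>i\<^esub>\<close>-measurable weights \<open>\<xi>\<^sub>i\<close>; it equals \<open>\<xi>\<^sub>i\<close> on \<open>(t\<^sub>i, t\<^bsub>i+1\<^esub>]\<close> and vanishes elsewhere.\<close>

definition simple_data ::
  "'a measure \<Rightarrow> (real \<Rightarrow> 'a measure) \<Rightarrow> nat \<Rightarrow> (nat \<Rightarrow> real) \<Rightarrow> (nat \<Rightarrow> 'a \<Rightarrow> real) \<Rightarrow> bool" where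
  "simple_data P F n t \<xi> \<longleftrightarrow>
     0 \<le> t 0 \<and> (\<forall>i<n. t i < t (Suc i)) \<and>
     (\<forall>i<n. \<xi> i \<in> borel_measurable (F (t i)) \<and> (\<exists>K. \<forall>\<omega>\<in>space P. \<bar>\<xi> i \<omega>\<bar> \<le> K))"

definition simple_process :: "nat \<Rightarrow> (nat \<Rightarrow> real) \<Rightarrow> (nat \<Rightarrow> 'a \<Rightarrow> real) \<Rightarrow> real \<Rightarrow> 'a \<Rightarrow> real" where
  "simple_process n t \<xi> s \<omega> = (\<Sum>i<n. \<xi> i \<omega> * indicator {t i<..t (Suc i)} s)"

definition simple_integral ::
  "(real \<Rightarrow> 'a \<Rightarrow> real) \<Rightarrow> nat \<Rightarrow> (nat \<Rightarrow> real) \<Rightarrow> (nat \<Rightarrow> 'a \<Rightarrow> real) \<Rightarrow> real \<Rightarrow> 'a \<Rightarrow> real" where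
  "simple_integral B n t \<xi> s \<omega> =
     (\<Sum>i<n. \<xi> i \<omega> * (B (min s (t (Suc i))) \<omega> - B (min s (t i)) \<omega>))"

text \<open>\<open>I\<^sub>t = \<integral>\<^sub>0\<^sup>t H\<^sub>s dB\<^sub>s\<close> for all \<open>t \<ge> 0\<close>, for an integrand \<open>H\<close> that is progressive with respect to
  the augmented filtration of \<open>B\<close> and almost surely locally square integrable: \<open>I\<close> is the adapted
  continuous process obtained as the limit in probability of the integrals of simple processes
  \<open>H\<^sup>k\<close> with \<open>\<integral>\<^sub>0\<^sup>t (H\<^sup>k\<^sub>s - H\<^sub>s)\<^sup>2 ds \<longlonglongrightarrow> 0\<close> in probability. It is unique up to indistinguishability.\<close>

definition locally_square_integrable :: "'a measure \<Rightarrow> (real \<Rightarrow> 'a \<Rightarrow> real) \<Rightarrow> bool" where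
  "locally_square_integrable P H \<longleftrightarrow>
     (\<forall>t\<ge>0. AE \<omega> in P. (\<integral>\<^sup>+s\<in>{0..t}. ennreal ((H s \<omega>)\<^sup>2) \<partial>lborel) < \<infinity>)"

definition ito_integral ::
  "'a measure \<Rightarrow> (real \<Rightarrow> 'a \<Rightarrow> real) \<Rightarrow> (real \<Rightarrow> 'a \<Rightarrow> real) \<Rightarrow> (real \<Rightarrow> 'a \<Rightarrow> real) \<Rightarrow> bool" where
  "ito_integral P B H I \<longleftrightarrow>
     progressive (aug_filtration P B) H \<and> locally_square_integrable P H \<and>
     adapted (aug_filtration P B) I \<and> continuous_paths P I \<and>
     (\<exists>n t \<xi>. (\<forall>k. simple_data P (aug_filtration P B) (n k) (t k) (\<xi> k)) \<and>
        (\<forall>u\<ge>0. \<forall>\<epsilon>>0.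
           (\<lambda>k. measure P {\<omega>\<in>space P. ennreal \<epsilon> <
              (\<integral>\<^sup>+s\<in>{0..u}. ennreal ((simple_process (n k) (t k) (\<xi> k) s \<omega> - H s \<omega>)\<^sup>2) \<partial>lborel)})
             \<longlonglongrightarrow> 0 \<and>
           (\<lambda>k. measure P {\<omega>\<in>space P. \<epsilon> <
              \<bar>simple_integral B (n k) (t k) (\<xi> k) u \<omega> - I u \<omega>\<bar>}) \<longlonglongrightarrow> 0))"


section \<open>The controlled wealth and the shortfall problem\<close>

text \<open>\<open>\<pi>\<close> is an admissible strategy with wealth \<open>W\<close> started at \<open>w\<close>. The filtration in the
  measurability condition on \<open>\<pi>\<close> is the augmentation of the one generated by \<open>W\<close>. The wealth itself
  is adapted to the augmented filtration of \<open>B\<close>, so that it neither anticipates \<open>B\<close> nor carries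
  information about a time of death that is independent of \<open>B\<close>.\<close>

definition admissible ::
  "'a measure \<Rightarrow> (real \<Rightarrow> 'a \<Rightarrow> real) \<Rightarrow> real \<Rightarrow> real \<Rightarrow> real \<Rightarrow> real \<Rightarrow> real \<Rightarrow>
     (real \<Rightarrow> 'a \<Rightarrow> real) \<Rightarrow> (real \<Rightarrow> 'a \<Rightarrow> real) \<Rightarrow> bool" where
  "admissible P B r \<mu> \<sigma> c w \<pi> W \<longleftrightarrow>
     progressive (aug_filtration P W) \<pi> \<and> locally_square_integrable P \<pi> \<and>
     adapted (aug_filtration P B) W \<and> continuous_paths P W \<and>
     (\<exists>I. ito_integral P B \<pi> I \<and>
        (AE \<omega> in P. \<forall>t\<ge>0.
           W t \<omega> = w + (LINT s:{0..t}|lborel. r * W s \<omega> + (\<mu> - r) * \<pi> s \<omega> - c) + \<sigma> * I t \<omega>))"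

definition running_min :: "real \<Rightarrow> (real \<Rightarrow> 'a \<Rightarrow> real) \<Rightarrow> real \<Rightarrow> 'a \<Rightarrow> real" where
  "running_min m W t \<omega> = min (INF s\<in>{0..t}. W s \<omega>) m"

definition shortfall_penalty ::
  "('a \<Rightarrow> real) \<Rightarrow> real \<Rightarrow> real \<Rightarrow> real \<Rightarrow> (real \<Rightarrow> 'a \<Rightarrow> real) \<Rightarrow> 'a \<Rightarrow> real" where
  "shortfall_penalty \<tau> x M m W \<omega> =
     max (x - W (\<tau> \<omega>) \<omega>) 0 * of_bool (running_min m W (\<tau> \<omega>) \<omega> > M)
     + (x - M) * of_bool (running_min m W (\<tau> \<omega>) \<omega> \<le> M)"

text \<open>The value function \<open>U(w, m; x, M)\<close>.\<close>

definition U_value ::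
  "'a measure \<Rightarrow> (real \<Rightarrow> 'a \<Rightarrow> real) \<Rightarrow> ('a \<Rightarrow> real) \<Rightarrow> real \<Rightarrow> real \<Rightarrow> real \<Rightarrow> real \<Rightarrow>
     real \<Rightarrow> real \<Rightarrow> real \<Rightarrow> real \<Rightarrow> real" where
  "U_value P B \<tau> r \<mu> \<sigma> c w m x M =
     Inf {(LINT \<omega>|P. shortfall_penalty \<tau> x M m W \<omega>) |\<pi> W. admissible P B r \<mu> \<sigma> c w \<pi> W}"

text \<open>\<open>\<phi>\<close> is an optimal feedback strategy for \<open>U(\<cdot>, \<cdot>; x, M)\<close>: investing \<open>\<phi>(W\<^sub>t)\<close> as long as the
  minimum wealth is above \<open>M\<close> attains the infimum. Once the minimum wealth has reached \<open>M\<close> the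
  penalty is fixed and the strategy is irrelevant.\<close>

definition optimal_feedback ::
  "'a measure \<Rightarrow> (real \<Rightarrow> 'a \<Rightarrow> real) \<Rightarrow> ('a \<Rightarrow> real) \<Rightarrow> real \<Rightarrow> real \<Rightarrow> real \<Rightarrow> real \<Rightarrow>
     real \<Rightarrow> real \<Rightarrow> (real \<Rightarrow> real) \<Rightarrow> bool" where
  "optimal_feedback P B \<tau> r \<mu> \<sigma> c x M \<phi> \<longleftrightarrow>
     (\<forall>w m. M < m \<and> m \<le> w \<and> w < c / r \<longrightarrow>
        (\<exists>\<pi> W. admissible P B r \<mu> \<sigma> c w \<pi> W \<and>
           (AE \<omega> in P. \<forall>t\<ge>0. running_min m W t \<omega> > M \<longrightarrow> \<pi> t \<omega> = \<phi> (W t \<omega>)) \<and>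
           (LINT \<omega>|P. shortfall_penalty \<tau> x M m W \<omega>) = U_value P B \<tau> r \<mu> \<sigma> c w m x M))"


section \<open>The Hamilton--Jacobi--Bellman equation\<close>

text \<open>The expression that is minimized over the investment \<open>a\<close> when the wealth is \<open>w\<close>.\<close>

definition hamiltonian ::
  "real \<Rightarrow> real \<Rightarrow> real \<Rightarrow> (real \<Rightarrow> real) \<Rightarrow> real \<Rightarrow> real \<Rightarrow> real" where
  "hamiltonian r \<mu> \<sigma> u w a = (\<mu> - r) * a * deriv u w + 1/2 * \<sigma>\<^sup>2 * a\<^sup>2 * deriv (deriv u) w"

text \<open>A classical solution on \<open>(M, c/r)\<close>. The minimum in the equation is attained, and the boundary
  values are those of a function that is continuous on \<open>[M, c/r]\<close>.\<close>

definition U_hjb_solution ::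
  "real \<Rightarrow> real \<Rightarrow> real \<Rightarrow> real \<Rightarrow> real \<Rightarrow> real \<Rightarrow> real \<Rightarrow> (real \<Rightarrow> real) \<Rightarrow> bool" where
  "U_hjb_solution r \<mu> \<sigma> c \<Lambda> x M u \<longleftrightarrow>
     continuous_on {M..c/r} u \<and>
     (\<forall>w\<in>{M<..<c/r}. u field_differentiable at w \<and> deriv u field_differentiable at w) \<and>
     (\<forall>w\<in>{M<..<c/r}. \<exists>a. is_arg_min (hamiltonian r \<mu> \<sigma> u w) (\<lambda>_. True) a \<and>
        \<Lambda> * (u w - max (x - w) 0) = (r * w - c) * deriv u w + hamiltonian r \<mu> \<sigma> u w a) \<and>
     u M = x - M \<and> u (c/r) = 0"


section \<open>Constants\<close>

definition delta_const :: "real \<Rightarrow> real \<Rightarrow> real \<Rightarrow> real" where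
  "delta_const r \<mu> \<sigma> = 1/2 * ((\<mu> - r) / \<sigma>)\<^sup>2"

definition p_const :: "real \<Rightarrow> real \<Rightarrow> real \<Rightarrow> real \<Rightarrow> real" where
  "p_const r \<mu> \<sigma> \<Lambda> =
     (let b = r + \<Lambda> + delta_const r \<mu> \<sigma> in 1 / (2 * r) * (b + sqrt (b\<^sup>2 - 4 * r * \<Lambda>)))"

end

theory Submission
  imports Defs
begin

text \<open>
  The statement is a comparison result for the Hamilton--Jacobi--Bellman equation. Put
  \<open>v = c/r - w\<close> and \<open>y = -u'(w)\<close>. Where \<open>y > 0\<close>, carrying out the minimization turns the equation
  into \<open>\<Lambda> (u - (x - w)\<^sub>+) = r v y - \<delta> y\<^sup>2 / u''\<close>, the optimal investment is
  \<open>(\<mu> - r) / \<sigma>\<^sup>2 \<cdot> y / u''\<close>, and the claim becomes \<open>(p - 1) y > v u''\<close>.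

  For \<open>w > x\<close> the function \<open>v\<^sup>p\<close> satisfies the equation with equality \<open>(p - 1) y = v u''\<close>, because \<open>p\<close>
  is the larger root of \<open>(p - 1) (r p - \<Lambda>) = \<delta> p\<close>. Its characteristic identity is \<open>v y = p u\<close>, so
  the deviation from it is measured by the defect \<open>H = v y - p u + p (x - w)\<^sub>+\<close>. The equation says
  \<open>C u'' H = y ((p - 1) y - v u'')\<close> with \<open>C = (p - 1) \<Lambda> / (\<delta> p) > 0\<close>, so the claim is
  equivalent to \<open>H > 0\<close> (lemma \<open>defect_identity\<close>). At the same time, for \<open>w \<noteq> x\<close>,
  \<open>H' = (p - 1) y - v u'' - p 1\<^bsub>w < x\<^esub>\<close>, so that \<open>H\<close> obeys a linear first-order
  equation, whose integrating factor is \<open>y\<^sup>C\<close> (lemma \<open>DERIV_scaled_defect\<close>):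
  \[ (H y^C)' = - p \, y^C \, 1_{w < x} . \]
  Hence \<open>H y\<^sup>C\<close> is constant on \<open>(x, c/r)\<close>. Convexity of \<open>u\<close> gives \<open>0 \<le> u \<le> v y\<close> with \<open>y\<close>
  bounded, so the constant is its limit \<open>0\<close> at \<open>c/r\<close> (lemma \<open>scaled_defect_at_x\<close>). To the left
  of \<open>x\<close> the product strictly decreases to the value \<open>0\<close> at \<open>x\<close>, which makes \<open>H\<close> positive there.

  The one delicate point is that \<open>u'\<close> might vanish near \<open>c/r\<close>. Below \<open>x\<close> this is excluded by
  the equation; above \<open>x\<close>, \<open>H\<close> vanishes together with \<open>y\<close>, and this keeps the derivative
  of \<open>H y\<^sup>C\<close> equal to \<open>0\<close>.
\<close>

section \<open>Quadratic minima, a product rule, and the constant \<open>p\<close>\<close>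

lemma quadratic_minimum_conditions:
  fixes A B a :: real
  assumes min: "\<And>y. A * a + B * a\<^sup>2 \<le> A * y + B * y\<^sup>2"
  shows "0 \<le> B" and "A + 2 * B * a = 0"
proof -
  define D where "D = A + 2 * B * a"
  have step: "0 \<le> D * h + B * h\<^sup>2" for h
    using min[of "a + h"] by (simp add: D_def power2_eq_square algebra_simps)
  show B: "0 \<le> B"
    using step[of 1] step[of "- 1"] by simp
  \<comment> \<open>The increment \<open>- D / (B + 1)\<close> points downhill; the \<open>1\<close> keeps it meaningful when \<open>B = 0\<close>.\<close>
  have "D * (- D / (B + 1)) + B * (- D / (B + 1))\<^sup>2 = - (D / (B + 1))\<^sup>2"
    using B by (simp add: power2_eq_square divide_simps) (simp add: algebra_simps)
  then have "(D / (B + 1))\<^sup>2 \<le> 0"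
    using step[of "- D / (B + 1)"] by simp
  then have "D / (B + 1) = 0"
    by simp
  then show "A + 2 * B * a = 0"
    using B by (simp add: D_def)
qed

text \<open>The second factor need not be differentiable: the zero of \<open>f\<close> absorbs its increments. This
  handles \<open>(-u')\<^sup>C\<close> with a small exponent at a zero of \<open>u'\<close>.\<close>

lemma has_real_derivative_mult_at_common_zero:
  fixes f g :: "real \<Rightarrow> real"
  assumes f: "(f has_real_derivative f') (at z)" and g: "isCont g z"
    and zero: "f z = 0" "g z = 0"
  shows "((\<lambda>t. f t * g t) has_real_derivative 0) (at z)"
proof -
  obtain q where q: "\<forall>t. f t - f z = q t * (t - z)" "isCont q z"
    using f by (auto simp: CARAT_DERIV)
  have "f t * g t - f z * g z = (q t * g t) * (t - z)" for t
    using q(1)[rule_format, of t] zero by simp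
  moreover have "isCont (\<lambda>t. q t * g t) z"
    using q(2) g by (intro continuous_intros)
  ultimately show ?thesis
    unfolding CARAT_DERIV using zero by (intro exI[of _ "\<lambda>t. q t * g t"]) simp
qed

lemma delta_const_pos:
  assumes "\<mu> > r" "\<sigma> > 0"
  shows "delta_const r \<mu> \<sigma> > 0"
  using assms by (simp add: delta_const_def)

lemma p_const_facts:
  assumes "r > 0" "\<mu> > r" "\<sigma> > 0" "\<Lambda> > 0"
  defines "p \<equiv> p_const r \<mu> \<sigma> \<Lambda>"
  shows p_const_gt_1: "p > 1"
    and p_const_root: "(p - 1) * (r * p - \<Lambda>) = delta_const r \<mu> \<sigma> * p"
proof -
  define d where "d = delta_const r \<mu> \<sigma>"
  define b where "b = r + \<Lambda> + d"
  define s where "s = sqrt (b\<^sup>2 - 4 * r * \<Lambda>)"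
  have d: "d > 0"
    using delta_const_pos assms by (simp add: d_def)
  have "0 \<le> d * (d + 2 * (r + \<Lambda>))"
    using d assms by simp
  also have "\<dots> = (b\<^sup>2 - 4 * r * \<Lambda>) - (r - \<Lambda>)\<^sup>2"
    by (simp add: b_def power2_eq_square algebra_simps)
  finally have disc: "(r - \<Lambda>)\<^sup>2 \<le> b\<^sup>2 - 4 * r * \<Lambda>"
    by simp
  then have s_ge: "\<bar>r - \<Lambda>\<bar> \<le> s"
    unfolding s_def using real_sqrt_le_mono by fastforce
  have "0 \<le> b\<^sup>2 - 4 * r * \<Lambda>"
    using disc zero_le_power2[of "r - \<Lambda>"] by linarith
  then have s_sq: "s * s = b\<^sup>2 - 4 * r * \<Lambda>"
    by (simp add: s_def)
  have p: "2 * r * p = b + s"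
    using assms(1) unfolding p_def p_const_def Let_def by (simp add: b_def s_def d_def)
  have "2 * r < 2 * r * p"
    using p s_ge d by (simp add: b_def)
  then show "p > 1"
    using assms(1) by simp
  have "(2 * r * p - b) * (2 * r * p - b) = b\<^sup>2 - 4 * r * \<Lambda>"
    using s_sq p by simp
  then have "4 * r * (r * p * p - b * p + \<Lambda>) = 0"
    by (simp add: power2_eq_square algebra_simps)
  then have "r * p * p - b * p + \<Lambda> = 0"
    using assms(1) by simp
  then show "(p - 1) * (r * p - \<Lambda>) = delta_const r \<mu> \<sigma> * p"
    by (simp add: b_def d_def algebra_simps)
qed


section \<open>Shape of a solution of the HJB equation\<close>

locale shortfall_hjb =
  fixes r \<mu> \<sigma> c \<Lambda> x M :: real and u :: "real \<Rightarrow> real"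
  assumes market: "r > 0" "\<mu> > r" "\<sigma> > 0" "\<Lambda> > 0"
    and level: "M < x" "x < c / r"
    and hjb: "U_hjb_solution r \<mu> \<sigma> c \<Lambda> x M u"
begin

abbreviation "\<delta> \<equiv> delta_const r \<mu> \<sigma>"
abbreviation "p \<equiv> p_const r \<mu> \<sigma> \<Lambda>"
abbreviation "u' \<equiv> deriv u"
abbreviation "u'' \<equiv> deriv (deriv u)"

lemmas \<delta>_pos = delta_const_pos[OF market(2,3)]
lemmas p_gt_1 = p_const_gt_1[OF market]
lemmas p_root = p_const_root[OF market]

lemma DERIV_u:
  assumes "M < w" "w < c / r"
  shows "(u has_real_derivative u' w) (at w)"
  using hjb assms by (simp add: U_hjb_solution_def field_differentiable_derivI)

lemma DERIV_u':
  assumes "M < w" "w < c / r"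
  shows "(u' has_real_derivative u'' w) (at w)"
  using hjb assms by (simp add: U_hjb_solution_def field_differentiable_derivI)

lemma continuous_u: "continuous_on {M..c/r} u"
  and u_at_M: "u M = x - M"
  and u_at_safe: "u (c/r) = 0"
  using hjb by (auto simp: U_hjb_solution_def)

lemma hjb_minimizer:
  assumes "M < w" "w < c / r"
  obtains a where "is_arg_min (hamiltonian r \<mu> \<sigma> u w) (\<lambda>_. True) a"
    and "\<Lambda> * (u w - max (x - w) 0) = (r * w - c) * u' w + hamiltonian r \<mu> \<sigma> u w a"
proof -
  have "w \<in> {M<..<c/r}"
    using assms by simp
  then show ?thesis
    using hjb that unfolding U_hjb_solution_def by blast
qed

lemma hamiltonian_arg_min_conditions:
  assumes "is_arg_min (hamiltonian r \<mu> \<sigma> u w) (\<lambda>_. True) a"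
  shows "0 \<le> u'' w" and "(\<mu> - r) * u' w + \<sigma>\<^sup>2 * u'' w * a = 0"
proof -
  have "hamiltonian r \<mu> \<sigma> u w a \<le> hamiltonian r \<mu> \<sigma> u w y" for y
    using assms by (simp add: is_arg_min_def not_less)
  moreover have "hamiltonian r \<mu> \<sigma> u w y = ((\<mu> - r) * u' w) * y + (1/2 * \<sigma>\<^sup>2 * u'' w) * y\<^sup>2" for y
    by (simp add: hamiltonian_def mult_ac)
  ultimately have min: "((\<mu> - r) * u' w) * a + (1/2 * \<sigma>\<^sup>2 * u'' w) * a\<^sup>2
      \<le> ((\<mu> - r) * u' w) * y + (1/2 * \<sigma>\<^sup>2 * u'' w) * y\<^sup>2" for y
    by simp
  show "0 \<le> u'' w"
    using quadratic_minimum_conditions(1)[OF min] market(3) by (simp add: zero_le_mult_iff)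
  show "(\<mu> - r) * u' w + \<sigma>\<^sup>2 * u'' w * a = 0"
    using quadratic_minimum_conditions(2)[OF min] by simp
qed

lemma u''_nonneg:
  assumes "M < w" "w < c / r"
  shows "0 \<le> u'' w"
  using hjb_minimizer[OF assms] hamiltonian_arg_min_conditions(1) by metis

text \<open>Where \<open>u'\<close> vanishes, the minimum of the Hamiltonian is \<open>0\<close>, so the equation degenerates
  to an identity for \<open>u\<close> itself.\<close>

lemma u_at_critical_point:
  assumes w: "M < w" "w < c / r" and crit: "u' w = 0"
  shows "u w = max (x - w) 0"
proof -
  obtain a where a: "is_arg_min (hamiltonian r \<mu> \<sigma> u w) (\<lambda>_. True) a"
      and eq: "\<Lambda> * (u w - max (x - w) 0) = (r * w - c) * u' w + hamiltonian r \<mu> \<sigma> u w a"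
    using hjb_minimizer[OF w] .
  have "u'' w * a = 0"
    using hamiltonian_arg_min_conditions(2)[OF a] crit market(3) by simp
  then have "hamiltonian r \<mu> \<sigma> u w a = 0"
    using crit by (auto simp: hamiltonian_def)
  then show ?thesis
    using eq crit market(4) by simp
qed

text \<open>Where \<open>u' \<noteq> 0\<close>, a minimum can only be attained if the Hamiltonian is strictly convex in the
  investment, and then the minimization can be carried out.\<close>

lemma reduced_hjb:
  assumes w: "M < w" "w < c / r" and u': "u' w \<noteq> 0"
  shows "0 < u'' w"
    and "\<Lambda> * (u w - max (x - w) 0) = (r * w - c) * u' w - \<delta> * (u' w)\<^sup>2 / u'' w"
proof -
  obtain a where a: "is_arg_min (hamiltonian r \<mu> \<sigma> u w) (\<lambda>_. True) a"
      and eq: "\<Lambda> * (u w - max (x - w) 0) = (r * w - c) * u' w + hamiltonian r \<mu> \<sigma> u w a"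
    using hjb_minimizer[OF w] .
  have foc: "(\<mu> - r) * u' w + \<sigma>\<^sup>2 * u'' w * a = 0"
    by (rule hamiltonian_arg_min_conditions(2)[OF a])
  then have "u'' w \<noteq> 0"
    using u' market(2) by auto
  then show pos: "0 < u'' w"
    using u''_nonneg[OF w] by simp
  have a_eq: "a = - (\<mu> - r) * u' w / (\<sigma>\<^sup>2 * u'' w)"
    using foc pos market(3) by (simp add: field_simps)
  have "hamiltonian r \<mu> \<sigma> u w a = - \<delta> * (u' w)\<^sup>2 / u'' w"
    using pos market(3) unfolding hamiltonian_def a_eq delta_const_def
    by (simp add: power2_eq_square divide_simps) (simp add: algebra_simps)
  then show "\<Lambda> * (u w - max (x - w) 0) = (r * w - c) * u' w - \<delta> * (u' w)\<^sup>2 / u'' w"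
    using eq by simp
qed

lemma u'_mono:
  assumes "M < v" "v \<le> w" "w < c / r"
  shows "u' v \<le> u' w"
  using assms by (intro DERIV_nonneg_imp_nondecreasing[of v w u']) (auto intro!: exI DERIV_u' u''_nonneg)

lemma u_mvt:
  assumes "M \<le> v" "v < w" "w \<le> c / r"
  obtains z where "v < z" "z < w" "u w - u v = (w - v) * u' z"
proof -
  have "continuous_on {v..w} u"
    using continuous_on_subset[OF continuous_u] assms by auto
  then obtain l z where z: "v < z" "z < w" "(u has_real_derivative l) (at z)"
      "u w - u v = (w - v) * l"
    using MVT[of v w u] assms DERIV_u
    by (metis less_le_trans order.strict_trans1 real_differentiable_def)
  then show ?thesis
    using that DERIV_imp_deriv by metis
qed

text \<open>If \<open>u\<close> increased anywhere, convexity would force it below its end value \<open>u (c/r) = 0\<close>; but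
  at an interior minimum it equals \<open>(x - w)\<^sub>+ \<ge> 0\<close>.\<close>

lemma u'_nonpos:
  assumes w: "M < w" "w < c / r"
  shows "u' w \<le> 0"
proof (rule ccontr)
  assume "\<not> u' w \<le> 0"
  then have pos: "0 < u' w" by simp
  obtain z where z: "w < z" "z < c / r" "u (c/r) - u w = (c / r - w) * u' z"
    using u_mvt[of w "c / r"] w by auto
  have "0 < u' z"
    using u'_mono[of w z] w z pos by simp
  then have "0 < (c / r - w) * u' z"
    using w by simp
  then have neg: "u w < 0"
    using z(3) u_at_safe by simp
  obtain w0 where w0: "w0 \<in> {M..c/r}" "\<And>t. t \<in> {M..c/r} \<Longrightarrow> u w0 \<le> u t"
    using continuous_attains_inf[OF _ _ continuous_u] level by fastforce
  have "u w0 < 0"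
    using w0(2)[of w] w neg by simp
  moreover have "u M > 0"
    using u_at_M level by simp
  ultimately have "w0 \<noteq> M" "w0 \<noteq> c / r"
    using u_at_safe by auto
  then have in0: "M < w0" "w0 < c / r"
    using w0(1) by auto
  have "u' w0 = 0"
  proof (rule DERIV_local_min[OF DERIV_u[OF in0]])
    show "0 < min (w0 - M) (c / r - w0)"
      using in0 by simp
    show "\<forall>t. \<bar>w0 - t\<bar> < min (w0 - M) (c / r - w0) \<longrightarrow> u w0 \<le> u t"
      using w0(2) by (auto simp: abs_if split: if_splits)
  qed
  then have "u w0 \<ge> 0"
    using u_at_critical_point[OF in0] by simp
  then show False
    using \<open>u w0 < 0\<close> by simp
qed

text \<open>The upper bound is convexity: the tangent at \<open>w\<close>, prolonged to \<open>c/r\<close>, ends at or below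
  \<open>u (c/r) = 0\<close>. In particular \<open>u\<close> vanishes wherever \<open>u'\<close> does.\<close>

lemma u_bounds:
  assumes w: "M < w" "w < c / r"
  shows "0 \<le> u w" and "u w \<le> (c / r - w) * - u' w"
proof -
  obtain z where z: "w < z" "z < c / r" "u (c/r) - u w = (c / r - w) * u' z"
    using u_mvt[of w "c / r"] w by auto
  then have eq: "u w = (c / r - w) * - u' z"
    using u_at_safe by simp
  have "0 \<le> - u' z"
    using u'_nonpos[of z] z w by simp
  then show "0 \<le> u w"
    unfolding eq using w by (intro mult_nonneg_nonneg) auto
  have "- u' z \<le> - u' w"
    using u'_mono[of w z] z w by simp
  then show "u w \<le> (c / r - w) * - u' w"
    unfolding eq using w by (intro mult_left_mono) auto
qed

lemma u'_neg_below_x: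
  assumes w: "M < w" "w < x"
  shows "u' w < 0"
proof -
  have w': "w < c / r"
    using w level by simp
  have "u' w \<noteq> 0"
  proof
    assume crit: "u' w = 0"
    then have "u w = 0"
      using u_bounds[OF w(1) w'] by simp
    then show False
      using u_at_critical_point[OF w(1) w' crit] w by simp
  qed
  then show ?thesis
    using u'_nonpos[OF w(1) w'] by simp
qed


section \<open>The defect and its integrating factor\<close>

text \<open>The first two terms cancel for multiples of \<open>(c/r - w)\<^sup>p\<close>. The last term absorbs the terminal
  penalty \<open>(x - w)\<^sub>+\<close> of the equation, so that \<open>defect_identity\<close> has the same form on both sides of \<open>x\<close>.\<close>

definition "defect w = (c / r - w) * - u' w - p * u w + p * max (x - w) 0"

text \<open>The exponent of the integrating factor \<open>(-u')\<^sup>C\<close>.\<close>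

definition "C = (p - 1) * \<Lambda> / (\<delta> * p)"

definition "scaled_defect w = defect w * (- u' w) powr C"

lemma C_pos: "C > 0"
  using p_gt_1 \<delta>_pos market by (simp add: C_def)

text \<open>Eliminating \<open>u\<close> from the defect by the equation leaves an expression in \<open>u'\<close> and \<open>u''\<close> alone;
  the coefficient of \<open>u''\<close> is normalized by the quadratic equation for \<open>p\<close>.\<close>

lemma defect_identity:
  assumes w: "M < w" "w < c / r" and neg: "u' w < 0"
  shows "C * u'' w * defect w / (- u' w) = (p - 1) * - u' w - (c / r - w) * u'' w"
proof -
  define y where "y = - u' w"
  define q where "q = u'' w"
  define v where "v = c / r - w"
  define s where "s = max (x - w) 0"
  have y: "y > 0"
    using neg by (simp add: y_def)
  have q: "q > 0"
    using reduced_hjb(1)[OF w] neg by (simp add: q_def)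
  have eq: "\<Lambda> * (u w - s) = r * v * y - \<delta> * y\<^sup>2 / q"
  proof -
    have rv: "r * v = c - r * w"
      using market(1) by (simp add: v_def field_simps)
    have "r * v * y = (r * w - c) * u' w"
      unfolding rv by (simp add: y_def algebra_simps)
    then show ?thesis
      using reduced_hjb(2)[OF w] neg by (simp add: y_def q_def s_def)
  qed
  have "\<Lambda> * defect w = \<Lambda> * v * y - p * (\<Lambda> * (u w - s))"
    by (simp add: defect_def y_def v_def s_def algebra_simps)
  then have L: "\<Lambda> * defect w = p * \<delta> * y\<^sup>2 / q - (r * p - \<Lambda>) * v * y"
    unfolding eq by (simp add: algebra_simps)
  have "C * q * defect w / y = (p - 1) * q / (\<delta> * p * y) * (\<Lambda> * defect w)"
    by (simp add: C_def)
  also have "\<dots> = (p - 1) * y - ((p - 1) * (r * p - \<Lambda>)) * v * q / (\<delta> * p)"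
    unfolding L using p_gt_1 \<delta>_pos y q
    by (simp add: power2_eq_square field_simps)
  also have "\<dots> = (p - 1) * y - v * q"
    unfolding p_root using p_gt_1 \<delta>_pos by simp
  finally show ?thesis
    by (simp add: y_def q_def v_def)
qed

text \<open>Here and in \<open>DERIV_scaled_defect\<close>, the parameter \<open>e\<close> is the slope of \<open>(x - w)\<^sub>+\<close>, namely \<open>-1\<close> below and \<open>0\<close> above \<open>x\<close>.\<close>

lemma DERIV_defect:
  assumes w: "M < w" "w < c / r"
    and kink: "((\<lambda>t. max (x - t) 0) has_real_derivative e) (at w)"
  shows "(defect has_real_derivative (p - 1) * - u' w - (c / r - w) * u'' w + p * e) (at w)"
  unfolding defect_def [abs_def]
  by (rule derivative_eq_intros DERIV_u[OF w] DERIV_u'[OF w] kink refl)+ (simp add: algebra_simps)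

text \<open>The logarithmic derivative of \<open>(-u')\<^sup>C\<close> is \<open>C u'' / u'\<close>. By \<open>defect_identity\<close> its
  contribution cancels the derivative of the defect except for the term that comes from the penalty.\<close>

lemma DERIV_scaled_defect:
  assumes w: "M < w" "w < c / r" and neg: "u' w < 0"
    and kink: "((\<lambda>t. max (x - t) 0) has_real_derivative e) (at w)"
  shows "(scaled_defect has_real_derivative p * e * (- u' w) powr C) (at w)"
proof -
  define D where "D = (p - 1) * - u' w - (c / r - w) * u'' w"
  have D: "C * u'' w * defect w / (- u' w) = D"
    unfolding D_def by (rule defect_identity[OF w neg])
  have powr: "((\<lambda>t. (- u' t) powr C) has_real_derivative
      - (C * u'' w / (- u' w) * (- u' w) powr C)) (at w)"
  proof -
    have "((\<lambda>t. (- u' t) powr C) has_real_derivative C * (- u' w) powr (C - 1) * (- u'' w)) (at w)"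
      using DERIV_fun_powr[OF DERIV_minus[OF DERIV_u'[OF w]], of C] neg by simp
    moreover have "(- u' w) powr (C - 1) = (- u' w) powr C / (- u' w)"
      using neg by (simp add: powr_diff)
    ultimately show ?thesis
      by (simp add: mult_ac)
  qed
  have "(scaled_defect has_real_derivative
      (D + p * e) * (- u' w) powr C + - (C * u'' w / (- u' w) * (- u' w) powr C) * defect w) (at w)"
    unfolding scaled_defect_def [abs_def] D_def
    by (rule DERIV_mult[OF DERIV_defect[OF w kink] powr])
  moreover have "(D + p * e) * (- u' w) powr C + - (C * u'' w / (- u' w) * (- u' w) powr C) * defect w
      = (D + p * e - C * u'' w * defect w / (- u' w)) * (- u' w) powr C"
    by (simp add: algebra_simps)
  ultimately show ?thesis
    unfolding D by simp
qed

lemma isCont_minus_u'_powr: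
  assumes w: "M < w" "w < c / r"
  shows "isCont (\<lambda>t. (- u' t) powr C) w"
proof -
  have "\<forall>\<^sub>F t in at w. 0 \<le> - u' t"
    using eventually_at_in_open'[of "{M<..<c/r}" w] w u'_nonpos
    by (auto elim!: eventually_mono)
  then show ?thesis
    using DERIV_isCont[OF DERIV_u'[OF w]] C_pos
    unfolding isCont_def by (intro tendsto_powr2 tendsto_intros) auto
qed

lemma isCont_scaled_defect:
  assumes w: "M < w" "w < c / r"
  shows "isCont scaled_defect w"
proof -
  have "isCont defect w"
    unfolding defect_def [abs_def]
    using DERIV_isCont[OF DERIV_u[OF w]] DERIV_isCont[OF DERIV_u'[OF w]]
    by (intro continuous_intros)
  then show ?thesis
    unfolding scaled_defect_def [abs_def]
    by (rule continuous_mult[OF _ isCont_minus_u'_powr[OF w]])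
qed

text \<open>A zero of \<open>u'\<close> is not excluded here, but there \<open>u\<close> and hence the defect vanish as well.\<close>

lemma DERIV_scaled_defect_above_x:
  assumes w: "x < w" "w < c / r"
  shows "(scaled_defect has_real_derivative 0) (at w)"
proof -
  have w': "M < w"
    using w level by simp
  have kink: "((\<lambda>t. max (x - t) 0) has_real_derivative 0) (at w)"
    by (rule has_field_derivative_transform_within_open[where f = "\<lambda>_. 0" and S = "{x<..}"])
      (use w in \<open>auto intro!: derivative_eq_intros\<close>)
  show ?thesis
  proof (cases "u' w = 0")
    case False
    then show ?thesis
      using DERIV_scaled_defect[OF w' w(2) _ kink] u'_nonpos[OF w' w(2)] by simp
  next
    case True
    then have "u w = 0"
      using u_bounds[OF w' w(2)] by simp
    then have "defect w = 0"
      using True w by (simp add: defect_def)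
    then show ?thesis
      unfolding scaled_defect_def [abs_def]
      using True isCont_minus_u'_powr[OF w' w(2)]
      by (intro has_real_derivative_mult_at_common_zero[OF DERIV_defect[OF w' w(2) kink]]) auto
  qed
qed

text \<open>Both \<open>u\<close> and \<open>(c/r - w) (-u')\<close> are controlled by the distance to \<open>c/r\<close>, because \<open>-u'\<close> does
  not increase.  This forces the limit \<open>0\<close> at \<open>c/r\<close>, whether or not \<open>u'\<close> tends to \<open>0\<close>.\<close>

lemma abs_scaled_defect_le:
  assumes w: "x \<le> w" "w < c / r"
  shows "\<bar>scaled_defect w\<bar> \<le> p * (c / r - w) * - u' x * (- u' x) powr C"
proof -
  have w': "M < w"
    using w level by simp
  have y: "0 \<le> - u' w" "- u' w \<le> - u' x"
    using u'_nonpos[OF w' w(2)] u'_mono[of x w] w level by auto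
  have b: "0 \<le> u w" "u w \<le> (c / r - w) * - u' w"
    by (rule u_bounds[OF w' w(2)])+
  have v0: "0 \<le> (c / r - w) * - u' w"
    using b by linarith
  have pu: "0 \<le> p * u w" "p * u w \<le> p * ((c / r - w) * - u' w)"
    using b p_gt_1 mult_left_mono[OF b(2), of p] by auto
  have pv: "(c / r - w) * - u' w \<le> p * ((c / r - w) * - u' w)"
    using mult_right_mono[OF less_imp_le[OF p_gt_1] v0] by simp
  have "defect w = (c / r - w) * - u' w - p * u w"
    using w by (simp add: defect_def)
  then have "\<bar>defect w\<bar> \<le> p * ((c / r - w) * - u' w)"
    using pu pv v0 by linarith
  also have "\<dots> \<le> p * ((c / r - w) * - u' x)"
    using y w p_gt_1 by (intro mult_left_mono) auto
  finally have "\<bar>defect w\<bar> \<le> p * (c / r - w) * - u' x"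
    by (simp only: mult.assoc)
  moreover have "(- u' w) powr C \<le> (- u' x) powr C"
    using y C_pos by (intro powr_mono2) auto
  ultimately have "\<bar>defect w\<bar> * (- u' w) powr C
      \<le> (p * (c / r - w) * - u' x) * (- u' x) powr C"
    by (intro mult_mono) (auto intro: order_trans[OF abs_ge_zero])
  then show ?thesis
    by (simp add: scaled_defect_def abs_mult)
qed

text \<open>The scaled defect is constant above \<open>x\<close> and tends to \<open>0\<close> at \<open>c/r\<close>.\<close>

lemma scaled_defect_at_x: "scaled_defect x = 0"
proof -
  define K where "K = p * - u' x * (- u' x) powr C"
  have const: "scaled_defect x = scaled_defect w" if w: "x < w" "w < c / r" for w
  proof (rule DERIV_isconst_end[OF w(1), symmetric])
    show "continuous_on {x..w} scaled_defect"
      using w level by (intro continuous_at_imp_continuous_on ballI isCont_scaled_defect) auto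
    show "(scaled_defect has_real_derivative 0) (at t)" if "x < t" "t < w" for t
      using that w by (intro DERIV_scaled_defect_above_x) auto
  qed
  have "\<bar>scaled_defect x\<bar> \<le> K * (c / r - w)" if w: "x < w" "w < c / r" for w
    using abs_scaled_defect_le[of w] const[OF w] w by (simp add: K_def mult_ac)
  then have "\<forall>\<^sub>F w in at_left (c / r). \<bar>scaled_defect x\<bar> \<le> K * (c / r - w)"
    using eventually_at_left[OF level(2)] level(2) by blast
  moreover have "((\<lambda>w. K * (c / r - w)) \<longlongrightarrow> K * (c / r - c / r)) (at_left (c / r))"
    by (intro tendsto_intros)
  ultimately have "\<bar>scaled_defect x\<bar> \<le> K * (c / r - c / r)"
    by (intro tendsto_lowerbound[of _ _ "at_left (c / r)"]) auto
  then show ?thesis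
    by simp
qed

text \<open>Below \<open>x\<close> the penalty makes the scaled defect strictly decreasing, and it ends at \<open>0\<close>.\<close>

lemma defect_pos_below_x:
  assumes w: "M < w" "w < x"
  shows "0 < defect w"
proof -
  have deriv: "(scaled_defect has_real_derivative - p * (- u' t) powr C) (at t)"
    if t: "w < t" "t < x" for t
  proof -
    have "((\<lambda>t. max (x - t) 0) has_real_derivative - 1) (at t)"
      by (rule has_field_derivative_transform_within_open[where f = "\<lambda>t. x - t" and S = "{..<x}"])
        (use t in \<open>auto intro!: derivative_eq_intros\<close>)
    from DERIV_scaled_defect[OF _ _ _ this] show ?thesis
      using t w level u'_neg_below_x[of t] by simp
  qed
  have "scaled_defect x < scaled_defect w"
  proof (rule DERIV_neg_imp_decreasing_open[OF w(2)])
    show "\<exists>d. (scaled_defect has_real_derivative d) (at t) \<and> d < 0" if t: "w < t" "t < x" for t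
      using deriv[OF t] u'_neg_below_x[of t] t w p_gt_1
      by (intro exI[of _ "- p * (- u' t) powr C"]) simp
    show "continuous_on {w..x} scaled_defect"
      using w level by (intro continuous_at_imp_continuous_on ballI isCont_scaled_defect) auto
  qed
  then have "0 < defect w * (- u' w) powr C"
    unfolding scaled_defect_at_x unfolding scaled_defect_def .
  then show ?thesis
    by (auto simp: zero_less_mult_iff)
qed

lemma hamiltonian_arg_min_lower_bound:
  assumes w: "M < w" "w < x"
    and a: "is_arg_min (hamiltonian r \<mu> \<sigma> u w) (\<lambda>_. True) a"
  shows "(\<mu> - r) / \<sigma>\<^sup>2 * (1 / (p - 1)) * (c / r - w) < a"
proof -
  have w': "w < c / r"
    using w level by simp
  have neg: "u' w < 0"
    by (rule u'_neg_below_x[OF w])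
  have q: "0 < u'' w"
    using reduced_hjb(1)[OF w(1) w'] neg by simp
  have "0 < C * u'' w * defect w / (- u' w)"
    using C_pos q defect_pos_below_x[OF w] neg by (intro divide_pos_pos mult_pos_pos) auto
  then have "(c / r - w) * u'' w < (p - 1) * - u' w"
    unfolding defect_identity[OF w(1) w' neg] by simp
  then have "1 / (p - 1) * (c / r - w) < - u' w / u'' w"
    using q p_gt_1 by (simp add: field_simps)
  then have "(\<mu> - r) / \<sigma>\<^sup>2 * (1 / (p - 1) * (c / r - w)) < (\<mu> - r) / \<sigma>\<^sup>2 * (- u' w / u'' w)"
    using market by (intro mult_strict_left_mono) auto
  also have "\<dots> = a"
    using hamiltonian_arg_min_conditions(2)[OF a] q market(3) by (simp add: field_simps)
  finally show ?thesis
    by (simp only: mult.assoc)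
qed

end


section \<open>The lower bound on the optimal investment\<close>

theorem theorem3p5:
  fixes P :: "'a measure" and B :: "real \<Rightarrow> 'a \<Rightarrow> real" and \<tau> :: "'a \<Rightarrow> real"
    and r \<mu> \<sigma> c \<Lambda> x M m w :: real
    and u \<pi>U :: "real \<Rightarrow> real"
  assumes space: "prob_space P" "complete_measure P"
    and bm: "brownian_motion P B"
    and death: "distributed P lborel \<tau> (exponential_density \<Lambda>)" "indep_of_process P \<tau> B"
    and market: "r > 0" "\<mu> > r" "\<sigma> > 0" "c > 0" "\<Lambda> > 0"
    and x: "M < x" "x < c / r"
    and U: "\<And>v n. M < n \<Longrightarrow> n \<le> v \<Longrightarrow> v < c / r \<Longrightarrow> U_value P B \<tau> r \<mu> \<sigma> c v n x M = u v"
    and hjb: "U_hjb_solution r \<mu> \<sigma> c \<Lambda> x M u"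
    and optimal: "optimal_feedback P B \<tau> r \<mu> \<sigma> c x M \<pi>U"
    and minimizer: "\<And>v. M < v \<Longrightarrow> v < c / r \<Longrightarrow>
      is_arg_min (hamiltonian r \<mu> \<sigma> u v) (\<lambda>_. True) (\<pi>U v)"
    and w: "M < m" "m \<le> w" "w < x"
  shows "\<pi>U w > (\<mu> - r) / \<sigma>\<^sup>2 * (1 / (p_const r \<mu> \<sigma> \<Lambda> - 1)) * (c / r - w)"
proof -
  interpret shortfall_hjb r \<mu> \<sigma> c \<Lambda> x M u
    by unfold_locales (fact market x hjb)+
  have "M < w" "w < c / r"
    using w x by auto
  then show ?thesis
    using hamiltonian_arg_min_lower_bound minimizer w by blast
qed

end
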